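(* Let $X$ and $Y$ be two crowded Hausdorff spaces of countable $\pi$-weight. If $X\times Y$ is countable dense homogeneous, then $X$ contains a subset homeomorphic to the Cantor set ${}^{\omega}2$ if and only if $Y$ contains a subset homeomorphic to ${}^{\omega}2$.
   Context: A space is crowded if it is non-empty and has no isolated points. A $\pi$-base in a space $X$ is a collection $\mathcal{B}$ of non-empty open subsets of $X$ such that every non-empty open $U\subset X$ contains some $V\in\mathcal{B}$; the $\pi$-weight of $X$ is the minimal cardinality of a $\pi$-base of $X$. A separable Hausdorff space $X$ is countable dense homogeneous (CDH) if for any two countable dense subsets $D,E$ of $X$ there is a homeomorphism $h:X\to X$ with $h[D]=E$ (separability is part of the definition). ${}^{\omega}2$ is $\{0,1\}^{\omega}$ with the product topology of discrete two-point spaces. *)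

theory Defs
  imports "HOL-Analysis.Analysis" "HOL-Library.Countable_Set_Type"
begin

definition crowded_space :: "'a topology \<Rightarrow> bool" where
  "crowded_space X \<longleftrightarrow> topspace X \<noteq> {} \<and> (\<forall>x\<in>topspace X. \<not> openin X {x})"

definition pi_base :: "'a topology \<Rightarrow> 'a set set \<Rightarrow> bool" where
  "pi_base X \<B> \<longleftrightarrow>
     (\<forall>V\<in>\<B>. openin X V \<and> V \<noteq> {}) \<and>
     (\<forall>U. openin X U \<and> U \<noteq> {} \<longrightarrow> (\<exists>V\<in>\<B>. V \<subseteq> U))"

text \<open>
  A cardinal is represented by a well-order, as in the cardinal theory of \<open>Main\<close>.
  The choice is harmless: a \<open>\<pi>\<close>-base of least cardinality exists, and any two of them
  are equipollent.
\<close>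

definition pi_weight :: "'a topology \<Rightarrow> 'a set rel" where
  "pi_weight X =
     card_of (SOME \<B>. pi_base X \<B> \<and> (\<forall>\<C>. pi_base X \<C> \<longrightarrow> (card_of \<B>, card_of \<C>) \<in> ordLeq))"

definition countable_pi_weight :: "'a topology \<Rightarrow> bool" where
  "countable_pi_weight X \<longleftrightarrow> (pi_weight X, natLeq) \<in> ordLeq"

lemma pi_base_minimal_exists:
  "\<exists>\<B>. pi_base X \<B> \<and> (\<forall>\<C>. pi_base X \<C> \<longrightarrow> (card_of \<B>, card_of \<C>) \<in> ordLeq)"
proof -
  define R where "R = card_of ` {\<B>. pi_base X \<B>}"
  have "pi_base X {U. openin X U \<and> U \<noteq> {}}"
    unfolding pi_base_def by blast
  then have 1: "R \<noteq> {}"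
    unfolding R_def by blast
  have 2: "\<forall>r\<in>R. Card_order r"
    unfolding R_def using card_of_Card_order by blast
  obtain r where "r \<in> R" "\<forall>s\<in>R. (r, s) \<in> ordLeq"
    using exists_minim_Card_order[OF 1 2] by blast
  then show ?thesis
    unfolding R_def by blast
qed

lemma countable_pi_weight_iff:
  "countable_pi_weight X \<longleftrightarrow> (\<exists>\<B>. pi_base X \<B> \<and> countable \<B>)"
proof -
  define \<B> where "\<B> = (SOME \<B>. pi_base X \<B> \<and>
      (\<forall>\<C>. pi_base X \<C> \<longrightarrow> (card_of \<B>, card_of \<C>) \<in> ordLeq))"
  have B: "pi_base X \<B>" "\<And>\<C>. pi_base X \<C> \<Longrightarrow> (card_of \<B>, card_of \<C>) \<in> ordLeq"
    using someI_ex[OF pi_base_minimal_exists[of X]] unfolding \<B>_def by blast+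
  have c: "(card_of \<C>, natLeq) \<in> ordLeq \<longleftrightarrow> countable \<C>" for \<C> :: "'a set set"
    by (rule countable_card_le_natLeq[symmetric])
  have w: "countable_pi_weight X \<longleftrightarrow> (card_of \<B>, natLeq) \<in> ordLeq"
    unfolding countable_pi_weight_def pi_weight_def \<B>_def ..
  show ?thesis
  proof
    assume "countable_pi_weight X"
    then show "\<exists>\<B>. pi_base X \<B> \<and> countable \<B>"
      using B(1) unfolding w c by blast
  next
    assume "\<exists>\<B>. pi_base X \<B> \<and> countable \<B>"
    then obtain \<C> where C: "pi_base X \<C>" "countable \<C>"
      by blast
    then show "countable_pi_weight X"
      unfolding w by (rule_tac ordLeq_transitive[OF B(2)[OF C(1)]]) (simp add: c)
  qed
qed

definition dense_subset :: "'a topology \<Rightarrow> 'a set \<Rightarrow> bool" where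
  "dense_subset X D \<longleftrightarrow> D \<subseteq> topspace X \<and> X closure_of D = topspace X"

definition countable_dense_homogeneous :: "'a topology \<Rightarrow> bool" where
  "countable_dense_homogeneous X \<longleftrightarrow>
     separable_space X \<and> Hausdorff_space X \<and>
     (\<forall>D E. countable D \<and> dense_subset X D \<and> countable E \<and> dense_subset X E \<longrightarrow>
        (\<exists>h. homeomorphic_map X X h \<and> h ` D = E))"

definition cantor_space :: "(nat \<Rightarrow> bool) topology" where
  "cantor_space = product_topology (\<lambda>_. discrete_topology UNIV) UNIV"

definition contains_cantor_set :: "'a topology \<Rightarrow> bool" where
  "contains_cantor_set X \<longleftrightarrow>
     (\<exists>S. S \<subseteq> topspace X \<and> subtopology X S homeomorphic_space cantor_space)"

end

theory Submission
  imports Defs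
begin

text \<open>
  Suppose that \<open>X\<close> contains a Cantor set; the other direction is symmetric. Countable \<open>\<pi>\<close>-bases
  give a countable dense set \<open>D\<close> of the product that meets every fibre of either projection in at
  most one point. Let \<open>C \<subseteq> X \<times> {y}\<close> be a Cantor set with a countable dense subset \<open>Q\<close>. A
  homeomorphism taking \<open>D \<union> Q\<close> onto \<open>D\<close> moves \<open>C\<close> to a Cantor set with a dense subset on which
  the projection to \<open>Y\<close> is injective, so this projection is not constant on any non-empty open
  subset of it. A Cantor scheme then gives a smaller Cantor set that embeds into \<open>Y\<close>.
\<close>

section \<open>Cantor sets as injective continuous images\<close>

lemma topspace_cantor_space [simp]: "topspace cantor_space = UNIV"
  by (simp add: cantor_space_def)

text \<open>Compactness of \<open>cantor_space\<close> makes a continuous injection into a Hausdorff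
  space closed, hence an embedding. Later constructions therefore only have to produce continuous
  injections.\<close>

lemma contains_cantor_set_iff_injective:
  assumes "Hausdorff_space Z"
  shows "contains_cantor_set Z \<longleftrightarrow> (\<exists>f. continuous_map cantor_space Z f \<and> inj f)"
proof
  assume "contains_cantor_set Z"
  then obtain S where S: "S \<subseteq> topspace Z" "subtopology Z S homeomorphic_space cantor_space"
    unfolding contains_cantor_set_def by blast
  then obtain f where f: "homeomorphic_map cantor_space (subtopology Z S) f"
    using homeomorphic_space homeomorphic_space_sym by metis
  then have "continuous_map cantor_space Z f"
    using continuous_map_in_subtopology homeomorphic_imp_continuous_map by blast
  moreover have "inj f"
    using homeomorphic_imp_injective_map[OF f] by simp
  ultimately show "\<exists>f. continuous_map cantor_space Z f \<and> inj f"
    by blast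
next
  assume "\<exists>f. continuous_map cantor_space Z f \<and> inj f"
  then obtain f where f: "continuous_map cantor_space Z f" "inj f"
    by blast
  have "compact_space cantor_space"
    by (simp add: cantor_space_def compact_space_product_topology compact_space_discrete_topology)
  then have "embedding_map cantor_space Z f"
    using f assms by (simp add: continuous_imp_closed_map injective_closed_imp_embedding_map)
  then have "homeomorphic_map cantor_space (subtopology Z (range f)) f"
    by (simp add: embedding_map_def)
  moreover have "range f \<subseteq> topspace Z"
    using f(1) continuous_map_image_subset_topspace by fastforce
  ultimately show "contains_cantor_set Z"
    unfolding contains_cantor_set_def
    using homeomorphic_map_imp_homeomorphic_space homeomorphic_space_sym by blast
qed

section \<open>Cylinders and continuity on the Cantor space\<close>

definition cylinder :: "bool list \<Rightarrow> (nat \<Rightarrow> bool) set" where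
  "cylinder s = {x. \<forall>k<length s. x k = s ! k}"

lemma cylinder_append_subset: "cylinder (s @ t) \<subseteq> cylinder s"
  by (auto simp: cylinder_def nth_append)

lemma cylinder_initial_segment: "cylinder (map x [0..<n]) = {y. \<forall>k<n. y k = x k}"
  by (auto simp: cylinder_def)

lemma openin_cantor_space_contains_cylinder:
  assumes "openin cantor_space U" "x \<in> U"
  obtains n where "cylinder (map x [0..<n]) \<subseteq> U"
proof -
  obtain W where W: "finite {i. W i \<noteq> UNIV}" "x \<in> Pi\<^sub>E UNIV W" "Pi\<^sub>E UNIV W \<subseteq> U"
    using assms unfolding cantor_space_def openin_product_topology_alt by force
  \<comment> \<open>A basic open set restricts only finitely many coordinates, so these all lie
    below some \<open>n\<close>.\<close>
  obtain n where n: "{i. W i \<noteq> UNIV} \<subseteq> {..<n}"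
    using W(1) finite_nat_iff_bounded by blast
  have "cylinder (map x [0..<n]) \<subseteq> Pi\<^sub>E UNIV W"
  proof
    fix y assume y: "y \<in> cylinder (map x [0..<n])"
    have "y i \<in> W i" for i
    proof (cases "i < n")
      case True
      then show ?thesis
        using y W(2) by (auto simp: cylinder_initial_segment PiE_iff)
    next
      case False
      then have "W i = UNIV"
        using n by auto
      then show ?thesis by simp
    qed
    then show "y \<in> Pi\<^sub>E UNIV W" by auto
  qed
  then show thesis
    using that W(3) by blast
qed

lemma openin_cantor_space_coordinates:
  "openin cantor_space {y. \<forall>k<n. y k = x k}"
proof -
  have "openin cantor_space (Pi\<^sub>E UNIV (\<lambda>k. if k < n then {x k} else UNIV))"
    unfolding cantor_space_def
    by (rule product_topology_basis) (auto intro: finite_subset[of _ "{..<n}"] split: if_splits)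
  also have "Pi\<^sub>E UNIV (\<lambda>k. if k < n then {x k} else UNIV) = {y. \<forall>k<n. y k = x k}"
    by (auto simp: PiE_iff split: if_splits)
  finally show ?thesis .
qed

text \<open>Each output coordinate is decided by a finite initial segment of the input, so it is
  constant on a basic open neighbourhood of every point.\<close>

lemma continuous_map_into_cantor_space_coordinates:
  assumes "\<And>x y k. (\<And>i. i \<le> k \<Longrightarrow> x i = y i) \<Longrightarrow> g x k = g y k"
  shows "continuous_map cantor_space cantor_space g"
proof -
  have "continuous_map cantor_space (discrete_topology UNIV) (\<lambda>x. g x k)" for k
  proof -
    have "openin cantor_space {x. g x k \<in> U}" for U
    proof (subst openin_subopen, intro ballI)
      fix x assume x: "x \<in> {x. g x k \<in> U}"
      have "{y. \<forall>i<Suc k. y i = x i} \<subseteq> {x. g x k \<in> U}"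
      proof clarify
        fix y assume y: "\<forall>i<Suc k. y i = x i"
        have "g y k = g x k"
          by (rule assms) (use y in auto)
        then show "g y k \<in> U" using x by simp
      qed
      then show "\<exists>T. openin cantor_space T \<and> x \<in> T \<and> T \<subseteq> {x. g x k \<in> U}"
        using openin_cantor_space_coordinates[of "Suc k" x] by blast
    qed
    then show ?thesis
      by (simp add: continuous_map_def)
  qed
  then show ?thesis
    by (subst (2) cantor_space_def) (simp add: continuous_map_componentwise_UNIV)
qed

section \<open>Cantor schemes of finite words\<close>

fun scheme_path :: "(bool list \<Rightarrow> bool \<Rightarrow> bool list) \<Rightarrow> (nat \<Rightarrow> bool) \<Rightarrow> nat \<Rightarrow> bool list" where
  "scheme_path e x 0 = []"
| "scheme_path e x (Suc n) = scheme_path e x n @ e (scheme_path e x n) (x n)"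

lemma scheme_path_cong:
  "(\<And>i. i < n \<Longrightarrow> x i = y i) \<Longrightarrow> scheme_path e x n = scheme_path e y n"
  by (induction n) auto

lemma length_scheme_path:
  assumes "\<And>s b. e s b \<noteq> []"
  shows "n \<le> length (scheme_path e x n)"
proof (induction n)
  case (Suc n)
  have "length (e (scheme_path e x n) (x n)) > 0"
    using assms by simp
  with Suc show ?case
    by (simp del: length_greater_0_conv)
qed simp

lemma scheme_path_prefix:
  assumes "m \<le> n"
  shows "\<exists>t. scheme_path e x n = scheme_path e x m @ t"
  using assms by (induction n rule: dec_induct) auto

text \<open>The infinite word along the branch \<open>x\<close>, where \<open>e s b\<close> is the
  block leading from the node \<open>s\<close> to its child \<open>b\<close>. If no block is empty,
  the word at stage \<open>Suc k\<close> has an entry at position \<open>k\<close>, and later stages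
  keep it.\<close>

definition scheme_limit ::
  "(bool list \<Rightarrow> bool \<Rightarrow> bool list) \<Rightarrow> (nat \<Rightarrow> bool) \<Rightarrow> nat \<Rightarrow> bool" where
  "scheme_limit e x k = scheme_path e x (Suc k) ! k"

lemma scheme_limit_in_cylinder:
  assumes "\<And>s b. e s b \<noteq> []"
  shows "scheme_limit e x \<in> cylinder (scheme_path e x n)"
proof -
  have "scheme_path e x (Suc k) ! k = scheme_path e x n ! k"
    if k: "k < length (scheme_path e x n)" for k
  \<comment> \<open>Of the words at stages \<open>n\<close> and \<open>Suc k\<close>, the earlier is
    a prefix of the later, and position \<open>k\<close> lies inside both.\<close>
  proof (cases "Suc k \<le> n")
    case True
    then obtain t where "scheme_path e x n = scheme_path e x (Suc k) @ t"
      using scheme_path_prefix by blast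
    moreover have "k < length (scheme_path e x (Suc k))"
      using length_scheme_path[of e "Suc k" x] assms by simp
    ultimately show ?thesis by (metis nth_append)
  next
    case False
    then obtain t where "scheme_path e x (Suc k) = scheme_path e x n @ t"
      using scheme_path_prefix[of n "Suc k" e x] by auto
    then show ?thesis using k by (metis nth_append)
  qed
  then show ?thesis
    by (simp add: cylinder_def scheme_limit_def)
qed

lemma continuous_map_scheme_limit:
  "continuous_map cantor_space cantor_space (scheme_limit e)"
proof (rule continuous_map_into_cantor_space_coordinates)
  fix x y :: "nat \<Rightarrow> bool" and k
  assume "\<And>i. i \<le> k \<Longrightarrow> x i = y i"
  then have "scheme_path e x (Suc k) = scheme_path e y (Suc k)"
    by (intro scheme_path_cong) simp
  then show "scheme_limit e x k = scheme_limit e y k"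
    by (simp only: scheme_limit_def)
qed

text \<open>Two branches share the node \<open>s\<close> reached at their first disagreement; there
  they enter different children, whose cylinders have disjoint images under \<open>f\<close>. The
  map \<open>f\<close> itself may be far from injective.\<close>

lemma inj_compose_scheme_limit:
  assumes ne: "\<And>s b. e s b \<noteq> []"
    and disj: "\<And>s. f ` cylinder (s @ e s True) \<inter> f ` cylinder (s @ e s False) = {}"
  shows "inj (f \<circ> scheme_limit e)"
proof (rule injI, rule ccontr)
  fix x y assume eq: "(f \<circ> scheme_limit e) x = (f \<circ> scheme_limit e) y" and "x \<noteq> y"
  then obtain n0 where "x n0 \<noteq> y n0" by blast
  define n where "n = (LEAST i. x i \<noteq> y i)"
  have n: "x n \<noteq> y n"
    unfolding n_def by (rule LeastI) fact
  have below: "\<And>i. i < n \<Longrightarrow> x i = y i"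
    unfolding n_def using not_less_Least by blast
  define s where "s = scheme_path e x n"
  have sy: "scheme_path e y n = s"
    unfolding s_def by (rule scheme_path_cong) (simp add: below)
  have "scheme_limit e x \<in> cylinder (s @ e s (x n))"
    using scheme_limit_in_cylinder[of e x "Suc n"] ne by (simp add: s_def)
  moreover have "scheme_limit e y \<in> cylinder (s @ e s (y n))"
    using scheme_limit_in_cylinder[of e y "Suc n"] ne by (simp add: sy)
  moreover have "f (scheme_limit e x) = f (scheme_limit e y)"
    using eq by simp
  ultimately have "f (scheme_limit e x) \<in> f ` cylinder (s @ e s (x n))"
    "f (scheme_limit e x) \<in> f ` cylinder (s @ e s (y n))"
    by (metis imageI)+
  with n disj[of s] show False
    by (cases "x n"; cases "y n") auto
qed

lemma cylinder_within_open_nhd: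
  assumes "openin cantor_space U" "x \<in> U" "x \<in> cylinder s"
  shows "\<exists>t. t \<noteq> [] \<and> cylinder (s @ t) \<subseteq> U"
proof -
  obtain n where n: "cylinder (map x [0..<n]) \<subseteq> U"
    using openin_cantor_space_contains_cylinder assms(1,2) by blast
  \<comment> \<open>As \<open>t\<close> has length \<open>Suc n\<close>, the word
    \<open>s @ t\<close> covers the first \<open>n\<close> entries of \<open>x\<close>, and
    \<open>t\<close> is non-empty even if \<open>n\<close> is 0.\<close>
  define t where "t = map x [length s..<length s + Suc n]"
  have "s = map x [0..<length s]"
    using assms(3) by (intro nth_equalityI) (auto simp: cylinder_def)
  then have "s @ t = map x [0..<length s + Suc n]"
    unfolding t_def by (metis map_append upt_add_eq_append zero_le)
  then have "cylinder (s @ t) \<subseteq> cylinder (map x [0..<n])"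
    by (auto simp: cylinder_initial_segment simp del: upt_Suc)
  moreover have "t \<noteq> []"
    by (simp add: t_def)
  ultimately show ?thesis
    using n by blast
qed

text \<open>Inside each cylinder, two different values of \<open>f\<close> are separated by disjoint
  open sets. By continuity their preimages contain smaller cylinders, which become the two children
  of the node; \<open>f\<close> is then injective on the limits of the scheme.\<close>

lemma contains_cantor_set_if_nowhere_constant:
  assumes Y: "Hausdorff_space Y" and f: "continuous_map cantor_space Y f"
    and nc: "\<And>s. \<exists>p\<in>cylinder s. \<exists>q\<in>cylinder s. f p \<noteq> f q"
  shows "contains_cantor_set Y"
proof -
  have "\<exists>r. (\<forall>b. r b \<noteq> []) \<and> f ` cylinder (s @ r True) \<inter> f ` cylinder (s @ r False) = {}" for s
  proof -
    obtain p q where pq: "p \<in> cylinder s" "q \<in> cylinder s" "f p \<noteq> f q"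
      using nc by blast
    have "f p \<in> topspace Y" "f q \<in> topspace Y"
      using continuous_map_image_subset_topspace[OF f] by auto
    then obtain A B where AB: "openin Y A" "openin Y B" "f p \<in> A" "f q \<in> B" "A \<inter> B = {}"
      using Y pq(3) unfolding Hausdorff_space_def disjnt_def by meson
    have "openin cantor_space (f -` A)" "openin cantor_space (f -` B)"
      using openin_continuous_map_preimage[OF f AB(1)] openin_continuous_map_preimage[OF f AB(2)]
      by (simp_all add: vimage_def)
    then obtain t u where tu: "t \<noteq> []" "u \<noteq> []"
      and "cylinder (s @ t) \<subseteq> f -` A" "cylinder (s @ u) \<subseteq> f -` B"
      using cylinder_within_open_nhd[of "f -` A" p s] cylinder_within_open_nhd[of "f -` B" q s]
        pq AB(3,4) by auto
    then have "f ` cylinder (s @ t) \<subseteq> A" "f ` cylinder (s @ u) \<subseteq> B"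
      by (simp_all add: image_subset_iff_subset_vimage)
    then have "f ` cylinder (s @ t) \<inter> f ` cylinder (s @ u) = {}"
      using Int_mono[of "f ` cylinder (s @ t)" A "f ` cylinder (s @ u)" B] AB(5) by simp
    with tu show ?thesis
      by (intro exI[of _ "\<lambda>b. if b then t else u"]) simp
  qed
  then obtain e where "\<And>s b. e s b \<noteq> []"
    "\<And>s. f ` cylinder (s @ e s True) \<inter> f ` cylinder (s @ e s False) = {}"
    by metis
  then have "inj (f \<circ> scheme_limit e)"
    by (rule inj_compose_scheme_limit)
  moreover have "continuous_map cantor_space Y (f \<circ> scheme_limit e)"
    using continuous_map_scheme_limit f by (rule continuous_map_compose)
  ultimately show ?thesis
    using contains_cantor_set_iff_injective[OF Y] by blast
qed

section \<open>Transporting a Cantor set by homogeneity\<close>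

lemma countable_set_two_points_in_cylinders:
  "\<exists>Q. countable Q \<and> (\<forall>s. \<exists>p\<in>cylinder s \<inter> Q. \<exists>q\<in>cylinder s \<inter> Q. p \<noteq> q)"
proof -
  \<comment> \<open>The point \<open>z s\<close> continues the word \<open>s\<close> by
    \<open>False\<close> forever. There are countably many words, and the two one-bit extensions of
    \<open>s\<close> give distinct points of its cylinder.\<close>
  define z :: "bool list \<Rightarrow> nat \<Rightarrow> bool" where "z s k = (k < length s \<and> s ! k)" for s k
  have z: "z (s @ t) \<in> cylinder s" for s t
    by (auto simp: cylinder_def z_def nth_append)
  have "z (s @ [True]) \<noteq> z (s @ [False])" for s
  proof
    assume "z (s @ [True]) = z (s @ [False])"
    then have "z (s @ [True]) (length s) = z (s @ [False]) (length s)" by simp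
    then show False by (simp add: z_def)
  qed
  then have "\<exists>p\<in>cylinder s \<inter> range z. \<exists>q\<in>cylinder s \<inter> range z. p \<noteq> q" for s
    using z by blast
  then show ?thesis
    by (intro exI[of _ "range z"]) simp
qed

text \<open>An arbitrary continuous \<open>\<pi>\<close> covers both projections. Non-constancy on a
  cylinder needs two points with different values, which is why \<open>Q\<close> has two points in
  every cylinder.\<close>

lemma contains_cantor_set_image_cdh:
  assumes cdh: "countable_dense_homogeneous Z" and Y: "Hausdorff_space Y"
    and \<pi>: "continuous_map Z Y \<pi>"
    and D: "countable D" "dense_subset Z D" "inj_on \<pi> D"
    and Z: "contains_cantor_set Z"
  shows "contains_cantor_set Y"
proof -
  have "Hausdorff_space Z"
    using cdh by (simp add: countable_dense_homogeneous_def)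
  then obtain \<phi> where \<phi>: "continuous_map cantor_space Z \<phi>" "inj \<phi>"
    using Z contains_cantor_set_iff_injective by blast
  obtain Q where Q: "countable Q" "\<And>s. \<exists>p\<in>cylinder s \<inter> Q. \<exists>q\<in>cylinder s \<inter> Q. p \<noteq> q"
    using countable_set_two_points_in_cylinders by auto
  have "\<phi> ` Q \<subseteq> topspace Z"
    using continuous_map_image_subset_topspace[OF \<phi>(1)] by auto
  then have "dense_subset Z (D \<union> \<phi> ` Q)"
    using D(2) closure_of_subset_topspace[of Z "\<phi> ` Q"]
    by (simp add: dense_subset_def closure_of_Un Un_absorb2)
  moreover have "countable (D \<union> \<phi> ` Q)"
    using D(1) Q(1) by simp
  \<comment> \<open>Homogeneity is applied to the enlarged set and \<open>D\<close> itself, so that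
    \<open>\<phi>\<close> followed by \<open>h\<close> sends \<open>Q\<close> into \<open>D\<close>,
    where \<open>\<pi>\<close> is injective.\<close>
  ultimately obtain h where h: "homeomorphic_map Z Z h" "h ` (D \<union> \<phi> ` Q) = D"
    using cdh D(1,2) unfolding countable_dense_homogeneous_def by blast
  have cont: "continuous_map cantor_space Y (\<pi> \<circ> (h \<circ> \<phi>))"
    by (intro continuous_map_compose[OF _ \<pi>] continuous_map_compose[OF \<phi>(1)]
        homeomorphic_imp_continuous_map h(1))
  show ?thesis
  proof (rule contains_cantor_set_if_nowhere_constant[OF Y cont])
    fix s
    obtain p q where pq: "p \<in> cylinder s" "p \<in> Q" "q \<in> cylinder s" "q \<in> Q" "p \<noteq> q"
      using Q(2) by blast
    have "\<phi> p \<noteq> \<phi> q" "\<phi> p \<in> topspace Z" "\<phi> q \<in> topspace Z"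
      using pq \<phi>(2) \<open>\<phi> ` Q \<subseteq> topspace Z\<close> by (auto dest: injD)
    then have "h (\<phi> p) \<noteq> h (\<phi> q)"
      using homeomorphic_imp_injective_map[OF h(1)] by (auto dest: inj_onD)
    moreover have "h (\<phi> p) \<in> D" "h (\<phi> q) \<in> D"
      using h(2) pq by blast+
    ultimately have "(\<pi> \<circ> (h \<circ> \<phi>)) p \<noteq> (\<pi> \<circ> (h \<circ> \<phi>)) q"
      using D(3) by (auto dest: inj_onD)
    then show "\<exists>p\<in>cylinder s. \<exists>q\<in>cylinder s. (\<pi> \<circ> (h \<circ> \<phi>)) p \<noteq> (\<pi> \<circ> (h \<circ> \<phi>)) q"
      using pq by blast
  qed
qed

section \<open>A countable dense set meeting every fibre at most once\<close>

lemma infinite_openin_crowded: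
  assumes "crowded_space X" "Hausdorff_space X" "openin X U" "U \<noteq> {}"
  shows "infinite U"
proof
  assume fin: "finite U"
  obtain x where x: "x \<in> U" using assms(4) by blast
  \<comment> \<open>The finite set \<open>U - {x}\<close> is closed, so \<open>x\<close> would be
    isolated.\<close>
  have "closedin X (U - {x})"
    using assms(2,3) fin openin_subset
    by (intro closedin_Hausdorff_finite) auto
  then have "openin X (U - (U - {x}))"
    using assms(3) by blast
  moreover have "U - (U - {x}) = {x}" using x by blast
  ultimately show False
    using assms(1,3) x openin_subset unfolding crowded_space_def by (metis subsetD)
qed

text \<open>Greedy choice: only finitely many values are taken at earlier indices, so the infinite
  set \<open>S n\<close> still offers a new one.\<close>

lemma injective_choice_infinite:
  fixes S :: "nat \<Rightarrow> 'a set"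
  assumes "\<And>n. infinite (S n)"
  obtains f where "inj f" "\<And>n. f n \<in> S n"
proof -
  have "\<exists>f. \<forall>n. f n \<in> S n \<and> f n \<notin> f ` {..<n}"
  proof (rule dependent_wellorder_choice)
    fix n and f :: "nat \<Rightarrow> 'a"
    show "\<exists>r. r \<in> S n \<and> r \<notin> f ` {..<n}"
      using assms[of n] by (meson finite_imageI finite_lessThan finite_subset subsetI)
  next
    fix r :: 'a and f g :: "nat \<Rightarrow> 'a" and n
    assume "\<And>m. m < n \<Longrightarrow> f m = g m"
    then have "f ` {..<n} = g ` {..<n}" by (simp add: image_def)
    then show "(r \<in> S n \<and> r \<notin> f ` {..<n}) = (r \<in> S n \<and> r \<notin> g ` {..<n})" by simp
  qed
  then obtain f where f: "\<And>n. f n \<in> S n" "\<And>n. f n \<notin> f ` {..<n}" by blast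
  have "inj f"
    using f(2) by (intro linorder_injI) (metis imageI lessThan_iff)
  then show thesis
    using f(1) that by blast
qed

text \<open>A point \<open>(f n, g n)\<close> is chosen in the \<open>n\<close>-th box formed from
  the two \<pi>-bases. The sides of the boxes are infinite, so \<open>f\<close> and \<open>g\<close>
  can be made injective; density follows as every non-empty open set contains a box.\<close>

lemma countable_dense_subset_prod_inj:
  assumes X: "crowded_space X" "Hausdorff_space X" "countable_pi_weight X"
    and Y: "crowded_space Y" "Hausdorff_space Y" "countable_pi_weight Y"
  obtains D where "countable D" "dense_subset (prod_topology X Y) D" "inj_on fst D" "inj_on snd D"
proof -
  obtain A where A: "pi_base X A" "countable A"
    using X(3) countable_pi_weight_iff by blast
  obtain B where B: "pi_base Y B" "countable B"
    using Y(3) countable_pi_weight_iff by blast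
  \<comment> \<open>The whole spaces are non-empty open sets, so each \<pi>-base has a member; an
    enumeration by all natural numbers needs this.\<close>
  have "A \<noteq> {}" "B \<noteq> {}"
    using A(1) B(1) X(1) Y(1) openin_topspace unfolding pi_base_def crowded_space_def by fast+
  then have ne: "A \<times> B \<noteq> {}" by blast
  define W where "W = from_nat_into (A \<times> B)"
  have W: "range W = A \<times> B"
    unfolding W_def using ne A(2) B(2) by (simp add: range_from_nat_into)
  have mem: "fst (W n) \<in> A" "snd (W n) \<in> B" for n
    using W by (metis mem_Times_iff rangeI)+
  have openX: "openin X (fst (W n))" "fst (W n) \<noteq> {}" for n
    using A(1) mem(1)[of n] by (simp_all add: pi_base_def)
  have openY: "openin Y (snd (W n))" "snd (W n) \<noteq> {}" for n
    using B(1) mem(2)[of n] by (simp_all add: pi_base_def)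
  have "infinite (fst (W n))" "infinite (snd (W n))" for n
    using openX[of n] openY[of n] infinite_openin_crowded X(1,2) Y(1,2) by metis+
  then obtain f g where f: "inj f" "\<And>n. f n \<in> fst (W n)" and g: "inj g" "\<And>n. g n \<in> snd (W n)"
    using injective_choice_infinite[of "\<lambda>n. fst (W n)"] injective_choice_infinite[of "\<lambda>n. snd (W n)"]
    by metis
  define D where "D = range (\<lambda>n. (f n, g n))"
  have "f n \<in> topspace X" "g n \<in> topspace Y" for n
    using f(2)[of n] g(2)[of n] openin_subset[OF openX(1)[of n]] openin_subset[OF openY(1)[of n]]
    by auto
  then have "D \<subseteq> topspace (prod_topology X Y)"
    by (auto simp: D_def)
  moreover have "prod_topology X Y closure_of D = topspace (prod_topology X Y)"
    unfolding dense_intersects_open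
  proof (intro allI impI, elim conjE)
    fix T assume "openin (prod_topology X Y) T" "T \<noteq> {}"
    then obtain U V where UV: "openin X U" "openin Y V" "U \<noteq> {}" "V \<noteq> {}" "U \<times> V \<subseteq> T"
      unfolding openin_prod_topology_alt by (metis all_not_in_conv surj_pair)
    then obtain U' V' where "U' \<in> A" "V' \<in> B" "U' \<subseteq> U" "V' \<subseteq> V"
      using A(1) B(1) unfolding pi_base_def by meson
    moreover from this obtain n where "W n = (U', V')"
      using W by (metis imageE mem_Sigma_iff)
    ultimately have "(f n, g n) \<in> T"
      using f(2)[of n] g(2)[of n] UV(5) by auto
    then show "D \<inter> T \<noteq> {}"
      unfolding D_def by blast
  qed
  ultimately have "dense_subset (prod_topology X Y) D"
    by (simp add: dense_subset_def)
  moreover have "inj_on fst D" "inj_on snd D"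
    using f(1) g(1) by (auto simp: D_def inj_on_def)
  ultimately show thesis
    by (intro that[of D]) (simp_all add: D_def)
qed

section \<open>Slices of the product and the conclusion\<close>

lemma contains_cantor_set_prod1:
  assumes "Hausdorff_space X" "Hausdorff_space Y" "contains_cantor_set X" "topspace Y \<noteq> {}"
  shows "contains_cantor_set (prod_topology X Y)"
proof -
  obtain f y where f: "continuous_map cantor_space X f" "inj f" and "y \<in> topspace Y"
    using assms contains_cantor_set_iff_injective by blast
  then have "continuous_map cantor_space (prod_topology X Y) (\<lambda>t. (f t, y))"
    by (simp add: continuous_map_pairedI)
  moreover have "inj (\<lambda>t. (f t, y))"
    using f(2) by (simp add: inj_def)
  ultimately show ?thesis
    using assms by (subst contains_cantor_set_iff_injective)
      (auto simp: Hausdorff_space_prod_topology)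
qed

lemma contains_cantor_set_prod2:
  assumes "Hausdorff_space X" "Hausdorff_space Y" "contains_cantor_set Y" "topspace X \<noteq> {}"
  shows "contains_cantor_set (prod_topology X Y)"
proof -
  obtain f x where f: "continuous_map cantor_space Y f" "inj f" and "x \<in> topspace X"
    using assms contains_cantor_set_iff_injective by blast
  then have "continuous_map cantor_space (prod_topology X Y) (\<lambda>t. (x, f t))"
    by (simp add: continuous_map_pairedI)
  moreover have "inj (\<lambda>t. (x, f t))"
    using f(2) by (simp add: inj_def)
  ultimately show ?thesis
    using assms by (subst contains_cantor_set_iff_injective)
      (auto simp: Hausdorff_space_prod_topology)
qed

theorem theorem2p3:
  fixes X :: "'a topology" and Y :: "'b topology"
  assumes "crowded_space X" and "Hausdorff_space X" and "countable_pi_weight X"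
    and "crowded_space Y" and "Hausdorff_space Y" and "countable_pi_weight Y"
    and "countable_dense_homogeneous (prod_topology X Y)"
  shows "contains_cantor_set X \<longleftrightarrow> contains_cantor_set Y"
proof -
  obtain D where D: "countable D" "dense_subset (prod_topology X Y) D" "inj_on fst D" "inj_on snd D"
    using countable_dense_subset_prod_inj assms(1-6) by blast
  have "topspace X \<noteq> {}" "topspace Y \<noteq> {}"
    using assms(1,4) by (simp_all add: crowded_space_def)
  \<comment> \<open>A Cantor set in one factor enters the product through a slice and reaches the
    other factor by its projection. The same \<open>D\<close> works in both directions, since both
    projections are injective on it.\<close>
  then show ?thesis
    using contains_cantor_set_prod1 contains_cantor_set_prod2 assms(2,5)
      contains_cantor_set_image_cdh[OF assms(7) assms(5) continuous_map_snd D(1,2,4)]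
      contains_cantor_set_image_cdh[OF assms(7) assms(2) continuous_map_fst D(1,2,3)]
    by blast
qed

end
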